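(* Let $w = w_1 \cdots w_\ell$ be a reduced word and let $\sigma = s_{w_1} s_{w_2}\cdots s_{w_\ell}$ be the permutation it defines. Then $\lambda(\sigma) = \lambda_f(w)$; that is, the top-left component of the diagram of $\sigma$ has the same shape as the frozen region of the Edelman--Greene insertion tableau $P(w)$.
   Context: Words and permutations. A word $w = w_1\cdots w_m$ with letters in $[n-1]=\{1,\dots,n-1\}$ defines the permutation $\sigma = s_{w_1}\cdots s_{w_m}\in\mathfrak{S}_n$, where $s_i=(i\ i{+}1)$ and transpositions act on positions, composed from the left: start with the one-line word $12\cdots n$ and for $k=1,\dots,m$ swap the entries in positions $w_k$ and $w_k+1$ (e.g. $1213$ gives $3241$). The word is reduced if $m = \mathrm{inv}(\sigma)$, the number of inversions of $\sigma$. $\mathcal{R}(\sigma)$ is the set of reduced words of $\sigma$. Edelman--Greene insertion. Tableaux are in English notation, cell $(i,j)$ in row $i$ and column $j$. To insert $x_0$ into a tableau $P$ with strictly increasing rows $P_1,P_2,\dots$ (rows beyond the last are empty), do for $i=0,1,2,\dots$: if $x_i>z$ for all $z\in P_{i+1}$, place $x_i$ at the end of $P_{i+1}$ and stop; if $x_i\in P_{i+1}$, leave row $P_{i+1}$ unchanged and insert $x_{i+1}=x_i+1$ in $P_{i+2}$; otherwise let $z'$ be the least element of $P_{i+1}$ with $z'>x_i$, replace it by $x_i$, and insert $x_{i+1}=z'$ in $P_{i+2}$. For a word $w=w_1\cdots w_m$, let $P^{(0)}=\emptyset$ and let $P^{(k)}$ be the result of inserting $w_k$ in $P^{(k-1)}$.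 The insertion tableau is $P(w)=P^{(m)}$. Frozen region. The frozen region of $P(w)$ is the set of cells $(i,j)$ with $P(w)_{i,j}=i+j-1$. For $w$ reduced, $P(w)$ is row and column strict, so the frozen region is the Young diagram of a (possibly empty) partition, denoted $\lambda_f(w)$. Diagram. The permutation matrix $M(\sigma)$ has 1s exactly in the entries $(\sigma(i),i)$ (row $\sigma(i)$, column $i$). The (Rothe) diagram $D(\sigma)$ is the set of cells left unshaded when all cells weakly to the east (in the same row) and weakly to the south (in the same column) of each 1-entry are shaded; i.e. $D(\sigma)=\{(r,c): r<\sigma(c),\ c<\sigma^{-1}(r)\}$. The top-left component $D_{(1,1)}(\sigma)$ is the (possibly empty) connected component of $D(\sigma)$ containing $(1,1)$ (cells being adjacent when they share an edge); it is the Young diagram of a partition denoted $\lambda(\sigma)$. *)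

theory Defs
  imports "HOL-Combinatorics.Combinatorics"
begin

section \<open>Words and permutations\<close>

text \<open>Elements of the symmetric group on \<open>{1..n}\<close> are functions on all of \<open>nat\<close> that fix every point
  outside \<open>{1..n}\<close>. Transpositions act on positions, hence composition on the right:
  \<open>\<sigma> \<circ> s\<^sub>i\<close> is the one-line word of \<open>\<sigma>\<close> with the entries in positions \<open>i\<close> and \<open>i + 1\<close> swapped.\<close>

definition word_perm :: "nat list \<Rightarrow> nat \<Rightarrow> nat" where
  "word_perm w = foldl (\<lambda>\<sigma> i. \<sigma> \<circ> Transposition.transpose i (i + 1)) id w"

definition inversions :: "nat \<Rightarrow> (nat \<Rightarrow> nat) \<Rightarrow> (nat \<times> nat) set" where
  "inversions n \<sigma> = {(i, j). i \<in> {1..n} \<and> j \<in> {1..n} \<and> i < j \<and> \<sigma> i > \<sigma> j}"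

definition reduced_word :: "nat \<Rightarrow> nat list \<Rightarrow> bool" where
  "reduced_word n w \<longleftrightarrow> set w \<subseteq> {1..<n} \<and> length w = card (inversions n (word_perm w))"

section \<open>Edelman--Greene insertion\<close>

text \<open>A tableau is the list of its nonempty rows. The insertion places or bumps a letter in
  the first row and then continues in the remaining rows.\<close>

fun eg_insert :: "nat \<Rightarrow> nat list list \<Rightarrow> nat list list" where
  "eg_insert x [] = [[x]]"
| "eg_insert x (r # rs) =
     (if \<forall>z\<in>set r. z < x then (r @ [x]) # rs
      else if x \<in> set r then r # eg_insert (x + 1) rs
      else (let z' = Min {z \<in> set r. x < z}
            in map (\<lambda>z. if z = z' then x else z) r # eg_insert z' rs))"

definition insertion_tableau :: "nat list \<Rightarrow> nat list list" where
  "insertion_tableau w = foldl (\<lambda>P x. eg_insert x P) [] w"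

text \<open>Cells \<open>(i, j)\<close> (row \<open>i\<close>, column \<open>j\<close>) are numbered from 1, list positions from 0.\<close>

definition tableau_cells :: "nat list list \<Rightarrow> (nat \<times> nat) set" where
  "tableau_cells P = {(i, j). i \<in> {1..length P} \<and> j \<in> {1..length (P ! (i - 1))}}"

definition tableau_entry :: "nat list list \<Rightarrow> nat \<Rightarrow> nat \<Rightarrow> nat" where
  "tableau_entry P i j = P ! (i - 1) ! (j - 1)"

definition frozen_region :: "nat list list \<Rightarrow> (nat \<times> nat) set" where
  "frozen_region P = {(i, j) \<in> tableau_cells P. tableau_entry P i j = i + j - 1}"

section \<open>Rothe diagrams\<close>

definition rothe_diagram :: "nat \<Rightarrow> (nat \<Rightarrow> nat) \<Rightarrow> (nat \<times> nat) set" where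
  "rothe_diagram n \<sigma> = {(r, c). r \<in> {1..n} \<and> c \<in> {1..n} \<and> r < \<sigma> c \<and> c < inv \<sigma> r}"

text \<open>Two cells are adjacent when they share an edge.\<close>

definition adjacent :: "nat \<times> nat \<Rightarrow> nat \<times> nat \<Rightarrow> bool" where
  "adjacent p q \<longleftrightarrow>
     \<bar>int (fst p) - int (fst q)\<bar> + \<bar>int (snd p) - int (snd q)\<bar> = 1"

definition component :: "(nat \<times> nat) set \<Rightarrow> nat \<times> nat \<Rightarrow> (nat \<times> nat) set" where
  "component D p = {q. p \<in> D \<and> (p, q) \<in> {(a, b). a \<in> D \<and> b \<in> D \<and> adjacent a b}\<^sup>*}"

definition top_left_component :: "nat \<Rightarrow> (nat \<Rightarrow> nat) \<Rightarrow> (nat \<times> nat) set" where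
  "top_left_component n \<sigma> = component (rothe_diagram n \<sigma>) (1, 1)"

section \<open>Partitions and shapes\<close>

definition is_partition :: "nat list \<Rightarrow> bool" where
  "is_partition \<alpha> \<longleftrightarrow> sorted_wrt (\<ge>) \<alpha> \<and> 0 \<notin> set \<alpha>"

definition young_diagram :: "nat list \<Rightarrow> (nat \<times> nat) set" where
  "young_diagram \<alpha> = {(i, j). i \<in> {1..length \<alpha>} \<and> j \<in> {1..\<alpha> ! (i - 1)}}"

definition is_young_diagram :: "(nat \<times> nat) set \<Rightarrow> bool" where
  "is_young_diagram A \<longleftrightarrow> (\<exists>\<alpha>. is_partition \<alpha> \<and> A = young_diagram \<alpha>)"

text \<open>Meaningful only for sets satisfying \<open>is_young_diagram\<close>.\<close>

definition shape :: "(nat \<times> nat) set \<Rightarrow> nat list" where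
  "shape A = (THE \<alpha>. is_partition \<alpha> \<and> A = young_diagram \<alpha>)"

lemma Suc_in_young_diagram:
  "(Suc i, Suc j) \<in> young_diagram \<alpha> \<longleftrightarrow> i < length \<alpha> \<and> j < \<alpha> ! i"
  by (auto simp: young_diagram_def)

lemma young_diagram_inject:
  assumes "is_partition \<alpha>" "is_partition \<beta>" "young_diagram \<alpha> = young_diagram \<beta>"
  shows "\<alpha> = \<beta>"
proof -
  have eq: "i < length \<alpha> \<and> j < \<alpha> ! i \<longleftrightarrow> i < length \<beta> \<and> j < \<beta> ! i" for i j
    using Suc_in_young_diagram[of i j \<alpha>] Suc_in_young_diagram[of i j \<beta>] assms(3) by simp
  have pos: "0 < \<gamma> ! i" if "i < length \<gamma>" "is_partition \<gamma>" for i \<gamma>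
    using that nth_mem[of i \<gamma>] unfolding is_partition_def by (cases "\<gamma> ! i") auto
  have less: "i < length \<alpha> \<longleftrightarrow> i < length \<beta>" for i
    using eq[of i 0] pos[of i \<alpha>] pos[of i \<beta>] assms(1,2) by blast
  have len: "length \<alpha> = length \<beta>"
    using less[of "length \<alpha>"] less[of "length \<beta>"] by simp
  show ?thesis
  proof (rule nth_equalityI[OF len])
    fix i assume "i < length \<alpha>"
    then show "\<alpha> ! i = \<beta> ! i"
      using eq[of i "\<alpha> ! i"] eq[of i "\<beta> ! i"] len by simp
  qed
qed

lemma shape_young_diagram: "is_partition \<alpha> \<Longrightarrow> shape (young_diagram \<alpha>) = \<alpha>"
  unfolding shape_def by (rule the_equality) (auto dest: young_diagram_inject)

definition lambda_perm :: "nat \<Rightarrow> (nat \<Rightarrow> nat) \<Rightarrow> nat list" where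
  "lambda_perm n \<sigma> = shape (top_left_component n \<sigma>)"

definition lambda_frozen :: "nat list \<Rightarrow> nat list" where
  "lambda_frozen w = shape (frozen_region (insertion_tableau w))"

end

theory Submission
  imports Defs
begin

text \<open>The two regions coincide as sets of cells: a cell
  \<open>(r, c)\<close> lies in the top-left component, and equally in the frozen region, if and only if
  \<open>\<sigma> 1, \<dots>, \<sigma> c\<close> all exceed \<open>r\<close>, that is, if and only if the permutation matrix has no 1 weakly
  north-west of the cell (\<open>northwest_free\<close>).

  For the component this is elementary. A cell with no 1 weakly north-west of it belongs to the
  diagram and is joined to \<open>(1, 1)\<close> inside the diagram by a row segment and a column segment;
  conversely, a step from such a cell to a neighbouring diagram cell cannot pass a 1.

  For the frozen region, \<open>w\<close> is first replaced by the reading word of its insertion tableau \<open>P\<close>,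
  the rows taken from bottom to top. Inserting a letter into a row changes the reading word only
  by commutations and braid moves, provided that the word is reduced, so the reading word still
  defines \<open>\<sigma>\<close> (\<open>reading_word_insertion_tableau\<close>). Hence \<open>\<sigma>\<close> is obtained from an argument by
  letting the rows of \<open>P\<close> act on it, the top row first. An increasing row sends a
  letter \<open>c\<close> that it contains to \<open>c + 1\<close>, and any other \<open>c\<close> down to the start of the run of
  consecutive letters of the row that ends in \<open>c - 1\<close>.
  If the cell \<open>(r, c)\<close> is frozen, then row \<open>i \<le> r\<close> begins with \<open>i, \<dots>, i + c - 1\<close>, so each of the
  first \<open>r\<close> rows raises the images of \<open>1, \<dots>, c\<close> by one, and the lower rows, whose letters exceed
  \<open>r\<close>, cannot bring these images back to \<open>r\<close>. If it is not frozen, consider the first row \<open>i \<le> r\<close>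
  that does not begin in this way: it sends one of the images down to \<open>i\<close>, where the rows below
  leave it. This is \<open>frozen_at_iff_word_perm\<close>; it needs the columns of \<open>P\<close>
  to be increasing, which insertion preserves (\<open>strictly_above_insert\<close>).\<close>

section \<open>Words as products of transpositions\<close>

lemma word_perm_Nil [simp]: "word_perm [] = id"
  by (simp add: word_perm_def)

lemma word_perm_snoc: "word_perm (w @ [x]) = word_perm w \<circ> transpose x (x + 1)"
  by (simp add: word_perm_def)

lemma word_perm_append [simp]: "word_perm (u @ v) = word_perm u \<circ> word_perm v"
proof (induction v rule: rev_induct)
  case (snoc x v)
  then show ?case
    using word_perm_snoc[of "u @ v" x] word_perm_snoc[of v x] by (simp add: comp_assoc)
qed simp

lemma word_perm_Cons [simp]: "word_perm (x # w) = transpose x (Suc x) \<circ> word_perm w"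
  using word_perm_append[of "[x]" w] word_perm_snoc[of "[]" x] by simp

lemma word_perm_permutes:
  assumes "set w \<subseteq> {1..<n}"
  shows "word_perm w permutes {1..n}"
  using assms
proof (induction w)
  case (Cons x w)
  then have "transpose x (Suc x) permutes {1..n}"
    by (intro permutes_swap_id) auto
  moreover have "word_perm w permutes {1..n}" using Cons by simp
  ultimately show ?case
    unfolding word_perm_Cons by (rule permutes_compose[rotated])
qed (simp add: permutes_id)

lemma word_perm_fixes_below:
  assumes "\<forall>x\<in>set w. c < x"
  shows "word_perm w c = c"
  using assms by (induction w) (auto simp: transpose_def)

lemma word_perm_preserves_lower_bound:
  assumes "\<forall>x\<in>set w. m \<le> x" "m \<le> c"
  shows "m \<le> word_perm w c"
  using assms by (induction w) (auto simp: transpose_def)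

lemma word_perm_commute:
  assumes "\<forall>a\<in>set A. Suc a < x \<or> Suc x < a"
  shows "word_perm A \<circ> transpose x (Suc x) = transpose x (Suc x) \<circ> word_perm A"
  using assms
proof (induction A)
  case (Cons a A)
  have swap: "transpose a (Suc a) \<circ> transpose x (Suc x) = transpose x (Suc x) \<circ> transpose a (Suc a)"
    using Cons.prems by (auto simp: fun_eq_iff transpose_def)
  have IH: "word_perm A \<circ> transpose x (Suc x) = transpose x (Suc x) \<circ> word_perm A"
    using Cons.prems by (intro Cons.IH) simp
  have "word_perm (a # A) \<circ> transpose x (Suc x)
      = transpose a (Suc a) \<circ> (word_perm A \<circ> transpose x (Suc x))"
    by (simp add: comp_assoc)
  also have "\<dots> = (transpose a (Suc a) \<circ> transpose x (Suc x)) \<circ> word_perm A"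
    unfolding IH by (simp only: comp_assoc)
  also have "\<dots> = transpose x (Suc x) \<circ> word_perm (a # A)"
    unfolding swap by (simp add: comp_assoc)
  finally show ?case .
qed simp

section \<open>Reduced words as shortest words\<close>

text \<open>Counting inversions bounds the length of every word of a permutation from below, so a reduced
  word is a shortest one. Minimality is the more convenient form, because it passes at once
  to factors of a word and to words of the same length and permutation.\<close>

definition shortest_word :: "nat \<Rightarrow> nat list \<Rightarrow> bool" where
  "shortest_word n w \<longleftrightarrow> set w \<subseteq> {1..<n} \<and>
     (\<forall>v. set v \<subseteq> {1..<n} \<longrightarrow> word_perm v = word_perm w \<longrightarrow> length w \<le> length v)"

lemma finite_inversions: "finite (inversions n \<sigma>)"
  by (rule finite_subset[of _ "{1..n} \<times> {1..n}"]) (auto simp: inversions_def)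

text \<open>Apart from \<open>(x, x + 1)\<close>, every inversion of \<open>\<sigma> \<circ> s\<^sub>x\<close> comes from an inversion of \<open>\<sigma>\<close> by applying
  \<open>s\<^sub>x\<close> to both positions.\<close>

lemma card_inversions_step:
  assumes "x \<in> {1..<n}"
  shows "card (inversions n (\<sigma> \<circ> transpose x (x + 1))) \<le> Suc (card (inversions n \<sigma>))"
proof -
  let ?s = "transpose x (x + 1)"
  have "inversions n (\<sigma> \<circ> ?s) \<subseteq> insert (x, x + 1) (map_prod ?s ?s ` inversions n \<sigma>)"
  proof
    fix p assume p: "p \<in> inversions n (\<sigma> \<circ> ?s)"
    obtain a b where ab: "p = (a, b)" by force
    show "p \<in> insert (x, x + 1) (map_prod ?s ?s ` inversions n \<sigma>)"
    proof (cases "p = (x, x + 1)")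
      case False
      with p ab assms have "(?s a, ?s b) \<in> inversions n \<sigma>"
        by (auto simp: inversions_def transpose_def split: if_splits)
      then have "map_prod ?s ?s (?s a, ?s b) \<in> map_prod ?s ?s ` inversions n \<sigma>"
        by (rule imageI)
      then show ?thesis using ab by simp
    qed simp
  qed
  then have "card (inversions n (\<sigma> \<circ> ?s)) \<le> card (insert (x, x + 1) (map_prod ?s ?s ` inversions n \<sigma>))"
    by (intro card_mono) (auto simp: finite_inversions)
  also have "\<dots> \<le> Suc (card (map_prod ?s ?s ` inversions n \<sigma>))"
    by (simp add: card_insert_le_m1 finite_inversions card_insert_if)
  also have "\<dots> \<le> Suc (card (inversions n \<sigma>))"
    by (simp add: card_image_le finite_inversions)
  finally show ?thesis .
qed

lemma card_inversions_le_length: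
  assumes "set w \<subseteq> {1..<n}"
  shows "card (inversions n (word_perm w)) \<le> length w"
  using assms
proof (induction w rule: rev_induct)
  case Nil
  have "inversions n (word_perm []) = {}" by (auto simp: inversions_def)
  then show ?case by (simp only: card.empty list.size)
next
  case (snoc x w)
  then have "card (inversions n (word_perm w)) \<le> length w" "x \<in> {1..<n}" by auto
  then have "card (inversions n (word_perm w \<circ> transpose x (x + 1))) \<le> Suc (length w)"
    using card_inversions_step[of x n "word_perm w"] by linarith
  then show ?case by (simp only: word_perm_snoc length_append_singleton)
qed

lemma reduced_word_imp_shortest: "reduced_word n w \<Longrightarrow> shortest_word n w"
  unfolding reduced_word_def shortest_word_def using card_inversions_le_length by metis

lemma shortest_word_cong:
  assumes "shortest_word n u" "word_perm v = word_perm u" "length v = length u"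
    "set v \<subseteq> {1..<n}"
  shows "shortest_word n v"
  using assms by (simp add: shortest_word_def)

lemma shortest_word_factor:
  assumes "shortest_word n (u @ v @ t)"
  shows "shortest_word n v"
  unfolding shortest_word_def
proof (intro conjI allI impI)
  show "set v \<subseteq> {1..<n}" using assms by (simp add: shortest_word_def)
  fix v' assume "set v' \<subseteq> {1..<n}" "word_perm v' = word_perm v"
  then have "length (u @ v @ t) \<le> length (u @ v' @ t)"
    using assms unfolding shortest_word_def
    by (metis le_sup_iff set_append word_perm_append)
  then show "length v \<le> length v'" by simp
qed

text \<open>If all letters of \<open>B\<close> commuted with \<open>x\<close>, the two occurrences of \<open>x\<close> could be moved together
  and cancelled.\<close>

lemma shortest_word_between_equal_letters:
  assumes "shortest_word n (x # B @ [x])"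
  shows "\<exists>b\<in>set B. b \<le> x + 1 \<and> x \<le> b + 1"
proof (rule ccontr)
  assume "\<not> ?thesis"
  then have "word_perm B \<circ> transpose x (Suc x) = transpose x (Suc x) \<circ> word_perm B"
    by (intro word_perm_commute) force
  then have "word_perm (x # B @ [x]) = word_perm B"
    by (simp add: fun_eq_iff)
  with assms have "length (x # B @ [x]) \<le> length B"
    unfolding shortest_word_def by auto
  then show False by simp
qed

section \<open>Insertion into one row\<close>

text \<open>The letter at which the insertion of \<open>x\<close> acts splits the row. The case \<open>y = x\<close>, where the row is
  left unchanged and \<open>x + 1\<close> is passed on, is kept together with the case \<open>x < y\<close> of a bumped letter:
  in both the new row is \<open>A @ x # B\<close>, and only the letter passed on (\<open>next_letter\<close>) differs.\<close>

lemma strict_row_cases: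
  fixes r :: "nat list"
  assumes "sorted_wrt (<) r"
  obtains (append) "\<forall>a\<in>set r. a < x"
  | (bump) A y B where "r = A @ y # B" "\<forall>a\<in>set A. a < x" "x \<le> y" "\<forall>b\<in>set B. y < b"
proof (cases "dropWhile (\<lambda>a. a < x) r")
  case Nil
  then show ?thesis using append by (simp add: dropWhile_eq_Nil_conv)
next
  case (Cons y B)
  define A where "A = takeWhile (\<lambda>a. a < x) r"
  have r: "r = A @ y # B"
    unfolding A_def Cons[symmetric] by simp
  moreover have "\<forall>a\<in>set A. a < x"
    unfolding A_def by (auto dest: set_takeWhileD)
  moreover have "x \<le> y"
    using hd_dropWhile[of "\<lambda>a. a < x" r] Cons by simp
  moreover have "\<forall>b\<in>set B. y < b"
    using assms r by (auto simp: sorted_wrt_append)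
  ultimately show ?thesis by (rule bump)
qed

definition row_insert :: "nat \<Rightarrow> nat list \<Rightarrow> nat list" where
  "row_insert x r = takeWhile (\<lambda>a. a < x) r @ x # tl (dropWhile (\<lambda>a. a < x) r)"

definition next_letter :: "nat \<Rightarrow> nat \<Rightarrow> nat" where
  "next_letter x y = (if y = x then x + 1 else y)"

lemma row_insert_append: "\<forall>a\<in>set r. a < x \<Longrightarrow> row_insert x r = r @ [x]"
proof -
  assume "\<forall>a\<in>set r. a < x"
  then have "takeWhile (\<lambda>a. a < x) r = r" "dropWhile (\<lambda>a. a < x) r = []"
    by (simp_all add: takeWhile_eq_all_conv dropWhile_eq_Nil_conv)
  then show ?thesis by (simp only: row_insert_def list.sel)
qed

lemma row_insert_bump:
  "\<forall>a\<in>set A. a < x \<Longrightarrow> x \<le> y \<Longrightarrow> row_insert x (A @ y # B) = A @ x # B"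
  by (simp add: row_insert_def)

lemma eg_insert_bump:
  assumes "\<forall>a\<in>set A. a < x" "x \<le> y" "\<forall>b\<in>set B. y < b"
  shows "eg_insert x ((A @ y # B) # rs) = (A @ x # B) # eg_insert (next_letter x y) rs"
proof (cases "y = x")
  case True
  then show ?thesis by (simp add: next_letter_def)
next
  case False
  with assms have xy: "x < y" by simp
  have notin: "x \<notin> set (A @ y # B)" using assms xy by auto
  have "Min {z \<in> set (A @ y # B). x < z} = y"
    using assms xy by (intro Min_eqI) (auto intro: less_imp_le)
  moreover have "map (\<lambda>z. if z = y then x else z) (A @ y # B) = A @ x # B"
    using assms xy by (auto intro!: map_idI)
  ultimately show ?thesis
    using notin xy False by (auto simp: next_letter_def Let_def simp del: map_append)
qed

lemma set_row_insert_subset: "set (row_insert x r) \<subseteq> insert x (set r)"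
proof -
  have "set (tl (dropWhile (\<lambda>a. a < x) r)) \<subseteq> set (dropWhile (\<lambda>a. a < x) r)"
    by (metis list.sel(2) list.set_sel(2) subsetI)
  then show ?thesis
    unfolding row_insert_def by (auto dest: set_takeWhileD set_dropWhileD)
qed

text \<open>The letter \<open>x\<close> on the right of a row is traded for the letter passed on, on the left of the new
  row. If \<open>x < y\<close>, this takes commutations only: \<open>x\<close> moves left across \<open>B\<close>, and \<open>y\<close> moves left across
  \<open>A\<close>. If \<open>y = x\<close>, the word would not be reduced unless \<open>x + 1\<close> follows \<open>x\<close> in the row, and then
  the braid relation turns \<open>x (x + 1) x\<close> into \<open>(x + 1) x (x + 1)\<close>. Membership of the letters in
  \<open>{1..<n}\<close> is recorded too: \<open>x + 1\<close> has it only because it occurs in the row.\<close>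

lemma word_perm_bump:
  assumes A: "\<forall>a\<in>set A. a < x" and B: "\<forall>b\<in>set B. y < b" and "x \<le> y"
    and sorted: "sorted_wrt (<) (A @ y # B)"
    and short: "shortest_word n ((A @ y # B) @ [x])"
  shows "word_perm ((A @ y # B) @ [x]) = word_perm (next_letter x y # A @ x # B)"
    and "set (next_letter x y # A @ x # B) \<subseteq> {1..<n}"
proof -
  have letters: "set (A @ y # B) \<subseteq> {1..<n}" "x \<in> {1..<n}"
    using short by (auto simp: shortest_word_def)
  let ?s = "\<lambda>i. transpose i (Suc i)"
  have "word_perm ((A @ y # B) @ [x]) = word_perm (next_letter x y # A @ x # B)
      \<and> set (next_letter x y # A @ x # B) \<subseteq> {1..<n}"
  proof (cases "y = x")
    case False
    with \<open>x \<le> y\<close> have xy: "x < y" by simp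
    have cB: "word_perm B \<circ> ?s x = ?s x \<circ> word_perm B"
      using B xy by (intro word_perm_commute) auto
    have cA: "word_perm A \<circ> ?s y = ?s y \<circ> word_perm A"
      using A xy by (intro word_perm_commute) auto
    have "word_perm ((A @ y # B) @ [x]) = (word_perm A \<circ> ?s y) \<circ> (word_perm B \<circ> ?s x)"
      by (simp add: comp_assoc)
    also have "\<dots> = word_perm (next_letter x y # A @ x # B)"
      unfolding cA cB using False by (simp add: next_letter_def comp_assoc)
    finally show ?thesis
      using letters False by (simp add: next_letter_def)
  next
    case True
    \<comment> \<open>All letters of \<open>B\<close> exceed \<open>x\<close>, so the only one that can obstruct the cancellation of the
      two letters \<open>x\<close> is \<open>x + 1\<close>, and it must be the first letter of \<open>B\<close>.\<close>
    have "shortest_word n (x # B @ [x])"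
      using shortest_word_factor[of n A "x # B @ [x]" "[]"] short True by simp
    then obtain b where b: "b \<in> set B" "b \<le> x + 1"
      using shortest_word_between_equal_letters by blast
    moreover have "x < b" using B True b(1) by blast
    ultimately have bx: "b = x + 1" by linarith
    obtain B1 B2 where "B = B1 @ (x + 1) # B2"
      using b bx by (auto dest: split_list)
    moreover have "B1 = []"
    proof (rule ccontr)
      assume "B1 \<noteq> []"
      then obtain c where "c \<in> set B1" by (meson last_in_set)
      then have "x < c" "c < x + 1"
        using sorted True \<open>B = B1 @ (x + 1) # B2\<close> by (simp_all add: sorted_wrt_append)
      then show False by linarith
    qed
    ultimately have B_eq: "B = (x + 1) # B2" by simp
    have cB: "word_perm B2 \<circ> ?s x = ?s x \<circ> word_perm B2"
      using sorted unfolding B_eq by (intro word_perm_commute) (auto simp: sorted_wrt_append)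
    have cA: "word_perm A \<circ> ?s (x + 1) = ?s (x + 1) \<circ> word_perm A"
      using A by (intro word_perm_commute) auto
    have braid: "?s x \<circ> ?s (x + 1) \<circ> ?s x = ?s (x + 1) \<circ> ?s x \<circ> ?s (x + 1)"
      by (auto simp: fun_eq_iff transpose_def)
    have "word_perm ((A @ y # B) @ [x])
        = word_perm A \<circ> ?s x \<circ> ?s (x + 1) \<circ> (word_perm B2 \<circ> ?s x)"
      using True B_eq by (simp add: comp_assoc)
    also have "\<dots> = word_perm A \<circ> (?s x \<circ> ?s (x + 1) \<circ> ?s x) \<circ> word_perm B2"
      unfolding cB by (simp add: comp_assoc)
    also have "\<dots> = (word_perm A \<circ> ?s (x + 1)) \<circ> ?s x \<circ> ?s (x + 1) \<circ> word_perm B2"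
      unfolding braid by (simp add: comp_assoc)
    also have "\<dots> = word_perm (next_letter x y # A @ x # B)"
      unfolding cA using True B_eq by (simp add: next_letter_def comp_assoc)
    finally show ?thesis
      using letters True B_eq by (simp add: next_letter_def)
  qed
  then show "word_perm ((A @ y # B) @ [x]) = word_perm (next_letter x y # A @ x # B)"
    and "set (next_letter x y # A @ x # B) \<subseteq> {1..<n}" by blast+
qed

section \<open>Increasing tableaux\<close>

definition strictly_above :: "nat list \<Rightarrow> nat list \<Rightarrow> bool" where
  "strictly_above r s \<longleftrightarrow> length s \<le> length r \<and> (\<forall>j<length s. r ! j < s ! j)"

definition head_row :: "nat list list \<Rightarrow> nat list" where
  "head_row P = (case P of [] \<Rightarrow> [] | r # _ \<Rightarrow> r)"

lemma head_row_simps [simp]: "head_row [] = []" "head_row (r # rs) = r"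
  by (simp_all add: head_row_def)

fun increasing_tableau :: "nat list list \<Rightarrow> bool" where
  "increasing_tableau [] \<longleftrightarrow> True"
| "increasing_tableau (r # rs) \<longleftrightarrow>
     sorted_wrt (<) r \<and> strictly_above r (head_row rs) \<and> increasing_tableau rs"

lemma sorted_head_row: "increasing_tableau P \<Longrightarrow> sorted_wrt (<) (head_row P)"
  by (cases P) auto

lemma head_row_eg_insert:
  assumes "increasing_tableau P"
  shows "head_row (eg_insert x P) = row_insert x (head_row P)"
proof (cases P)
  case Nil
  then show ?thesis by (simp add: row_insert_def)
next
  case (Cons r rs)
  with assms have "sorted_wrt (<) r" by simp
  then show ?thesis
  proof (cases rule: strict_row_cases[where x = x])
    case append
    then show ?thesis using Cons by (simp add: row_insert_append)
  next
    case (bump A y B)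
    then show ?thesis using Cons eg_insert_bump row_insert_bump by simp
  qed
qed

text \<open>The insertion path moves weakly to the left. In the next row \<open>s\<close>, the letter below \<open>y\<close> is larger
  than \<open>y\<close>, if it exists, so the letter passed on, which is at most \<open>y + 1\<close>, ends up in
  a column \<open>q\<close> no further right than that of \<open>y\<close>. There the upper row now has an entry of at most \<open>x\<close>,
  which is smaller than the letter passed on; in all other columns the upper entry has not
  grown and the lower one is unchanged.\<close>

lemma strictly_above_insert:
  assumes above: "strictly_above (A @ y # B) s" and s: "sorted_wrt (<) s"
    and A: "sorted_wrt (<) A" "\<forall>a\<in>set A. a < x" and "x \<le> y"
  shows "strictly_above (A @ x # B) (row_insert (next_letter x y) s)"
proof -
  let ?r = "A @ y # B" and ?r' = "A @ x # B" and ?z = "next_letter x y"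
  define q where "q = length (takeWhile (\<lambda>a. a < ?z) s)"
  have xz: "x < ?z" and zy: "?z \<le> y + 1"
    using \<open>x \<le> y\<close> by (auto simp: next_letter_def)
  have le: "?r' ! j \<le> ?r ! j" for j
    using \<open>x \<le> y\<close> by (simp add: nth_append nth_Cons split: nat.splits)
  have small: "?r' ! j \<le> x" if "j \<le> length A" for j
    using that A(2) by (auto simp: nth_append less_imp_le)
  have len: "length s \<le> length ?r" and lt: "j < length s \<Longrightarrow> ?r ! j < s ! j" for j
    using above by (auto simp: strictly_above_def)
  have q: "q \<le> length A"
  proof (rule ccontr)
    assume "\<not> q \<le> length A"
    then have lA: "length A < q" by simp
    then have "s ! length A < ?z"
      unfolding q_def by (metis (mono_tags, lifting) nth_mem set_takeWhileD takeWhile_nth)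
    moreover have "length A < length s"
      using lA length_takeWhile_le[of "\<lambda>a. a < ?z" s] unfolding q_def by linarith
    then have "y < s ! length A" using lt[of "length A"] by simp
    ultimately show False using zy by simp
  qed
  have new_row: "length (row_insert ?z s) \<le> length ?r' \<and>
      (\<forall>j<length (row_insert ?z s). row_insert ?z s ! j = (if j = q then ?z else s ! j) \<and>
        (j = q \<or> j < length s))"
    using s
  proof (cases rule: strict_row_cases[where x = "?z"])
    case append
    then have "q = length s" unfolding q_def by (simp add: takeWhile_eq_all_conv[THEN iffD2])
    then show ?thesis using append q by (auto simp: row_insert_append nth_append)
  next
    case (bump A' y' B')
    then have "q = length A'" unfolding q_def by simp
    then show ?thesis using bump len
      by (auto simp: row_insert_bump nth_append nth_Cons split: nat.splits)
  qed
  show ?thesis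
    unfolding strictly_above_def
  proof (intro conjI allI impI)
    fix j assume j: "j < length (row_insert ?z s)"
    show "?r' ! j < row_insert ?z s ! j"
    proof (cases "j = q")
      case True
      then show ?thesis using new_row j small[of q] q xz by simp
    next
      case False
      then show ?thesis using new_row j le[of j] lt[of j] by fastforce
    qed
  qed (rule conjunct1[OF new_row])
qed

lemma increasing_eg_insert:
  "increasing_tableau P \<Longrightarrow> increasing_tableau (eg_insert x P)"
proof (induction P arbitrary: x)
  case Nil
  then show ?case by (simp add: strictly_above_def)
next
  case (Cons r rs)
  then have r: "sorted_wrt (<) r" by simp
  then show ?case
  proof (cases rule: strict_row_cases[where x = x])
    case append
    have "strictly_above (r @ [x]) (head_row rs)"
      using Cons.prems by (auto simp: strictly_above_def nth_append)
    then show ?thesis using append Cons.prems by (simp add: sorted_wrt_append)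
  next
    case (bump A y B)
    have "strictly_above (A @ x # B) (row_insert (next_letter x y) (head_row rs))"
      using Cons.prems bump
      by (intro strictly_above_insert) (auto simp: sorted_wrt_append sorted_head_row)
    moreover have "sorted_wrt (<) (A @ x # B)"
      using r bump by (fastforce simp: sorted_wrt_append)
    ultimately show ?thesis
      using Cons bump eg_insert_bump head_row_eg_insert by simp
  qed
qed

section \<open>The reading word\<close>

definition reading_word :: "nat list list \<Rightarrow> nat list" where
  "reading_word P = concat (rev P)"

lemma reading_word_simps [simp]:
  "reading_word [] = []" "reading_word (r # rs) = reading_word rs @ r"
  by (simp_all add: reading_word_def)

text \<open>Length and range of letters are carried through the induction because they, together with the
  permutation, show that the word obtained is again a shortest one.\<close>

lemma reading_word_eg_insert:
  assumes "increasing_tableau P" "shortest_word n (reading_word P @ [x])"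
  shows "word_perm (reading_word (eg_insert x P)) = word_perm (reading_word P @ [x])
    \<and> length (reading_word (eg_insert x P)) = length (reading_word P @ [x])
    \<and> set (reading_word (eg_insert x P)) \<subseteq> {1..<n}"
  using assms
proof (induction P arbitrary: x)
  case Nil
  then show ?case by (simp add: shortest_word_def)
next
  case (Cons r rs)
  then have r: "sorted_wrt (<) r" by simp
  then show ?case
  proof (cases rule: strict_row_cases[where x = x])
    case append
    then show ?thesis using Cons.prems by (simp add: shortest_word_def)
  next
    case (bump A y B)
    let ?z = "next_letter x y"
    have short: "shortest_word n ((A @ y # B) @ [x])"
      using shortest_word_factor[of n "reading_word rs" "r @ [x]" "[]"] Cons.prems bump by simp
    note wb = word_perm_bump[OF bump(2) bump(4) bump(3) r[unfolded bump(1)] short]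
    have "shortest_word n (reading_word rs @ ?z # A @ x # B)"
    proof (rule shortest_word_cong[OF Cons.prems(2)])
      show "word_perm (reading_word rs @ ?z # A @ x # B) = word_perm (reading_word (r # rs) @ [x])"
        using wb(1) bump(1) by (simp add: comp_assoc)
      show "set (reading_word rs @ ?z # A @ x # B) \<subseteq> {1..<n}"
        using wb(2) Cons.prems(2) by (simp add: shortest_word_def)
    qed (simp add: bump(1))
    then have "shortest_word n (reading_word rs @ [?z])"
      using shortest_word_factor[of n "[]" "reading_word rs @ [?z]" "A @ x # B"] by simp
    with Cons have IH: "word_perm (reading_word (eg_insert ?z rs)) = word_perm (reading_word rs @ [?z])"
      "length (reading_word (eg_insert ?z rs)) = length (reading_word rs @ [?z])"
      "set (reading_word (eg_insert ?z rs)) \<subseteq> {1..<n}"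
      by auto
    have eq: "eg_insert x (r # rs) = (A @ x # B) # eg_insert ?z rs"
      using bump eg_insert_bump by simp
    show ?thesis
      using IH wb bump(1) unfolding eq by (simp add: comp_assoc)
  qed
qed

lemma insertion_tableau_snoc:
  "insertion_tableau (w @ [x]) = eg_insert x (insertion_tableau w)"
  by (simp add: insertion_tableau_def)

lemma insertion_tableau_increasing: "increasing_tableau (insertion_tableau w)"
proof (induction w rule: rev_induct)
  case Nil
  then show ?case by (simp add: insertion_tableau_def)
next
  case (snoc x w)
  then show ?case by (simp add: insertion_tableau_snoc increasing_eg_insert)
qed

lemma set_head_row_insertion_tableau: "set (head_row (insertion_tableau w)) \<subseteq> set w"
proof (induction w rule: rev_induct)
  case Nil
  then show ?case by (simp add: insertion_tableau_def)
next
  case (snoc x w)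
  then show ?case
    using set_row_insert_subset[of x "head_row (insertion_tableau w)"]
    by (auto simp: insertion_tableau_snoc head_row_eg_insert insertion_tableau_increasing)
qed

lemma reading_word_insertion_tableau:
  assumes "shortest_word n w"
  shows "word_perm (reading_word (insertion_tableau w)) = word_perm w"
proof -
  have "word_perm (reading_word (insertion_tableau w)) = word_perm w
     \<and> length (reading_word (insertion_tableau w)) = length w
     \<and> set (reading_word (insertion_tableau w)) \<subseteq> {1..<n}"
    using assms
  proof (induction w rule: rev_induct)
    case Nil
    then show ?case by (simp add: insertion_tableau_def)
  next
    case (snoc x w)
    have "shortest_word n w"
      using shortest_word_factor[of n "[]" w "[x]"] snoc.prems by simp
    with snoc have IH: "word_perm (reading_word (insertion_tableau w)) = word_perm w"
      "length (reading_word (insertion_tableau w)) = length w"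
      "set (reading_word (insertion_tableau w)) \<subseteq> {1..<n}"
      by auto
    then have "shortest_word n (reading_word (insertion_tableau w) @ [x])"
      using snoc.prems by (intro shortest_word_cong[OF snoc.prems]) (auto simp: shortest_word_def)
    from reading_word_eg_insert[OF insertion_tableau_increasing this] show ?case
      using IH by (simp add: insertion_tableau_snoc)
  qed
  then show ?thesis ..
qed

section \<open>Frozen cells and the permutation\<close>

text \<open>The last letter of a word acts first. In an increasing row, the letters above \<open>c\<close> fix \<open>c\<close>,
  the letter \<open>c\<close> raises it to \<open>c + 1\<close>, and the remaining letters are too small to move it again.\<close>

lemma word_perm_row_mem:
  assumes "sorted_wrt (<) r" "c \<in> set r"
  shows "word_perm r c = Suc c"
  using assms
proof (induction r)
  case (Cons a r)
  show ?case
  proof (cases "c = a")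
    case True
    with Cons.prems have "word_perm r c = c"
      by (intro word_perm_fixes_below) simp
    then show ?thesis using True by simp
  next
    case False
    with Cons show ?thesis by (auto simp: transpose_def)
  qed
qed simp

text \<open>Without the letter \<open>c\<close> in the row, the letters \<open>c - 1, c - 2, \<dots>, m\<close> act one after the other and
  bring \<open>c\<close> down to \<open>m\<close>.\<close>

lemma word_perm_row_run:
  assumes "sorted_wrt (<) r" "\<forall>a\<in>set r. m \<le> a" "{m..<c} \<subseteq> set r" "c \<notin> set r" "m \<le> c"
  shows "word_perm r c = m"
  using assms
proof (induction r arbitrary: m)
  case (Cons a r)
  show ?case
  proof (cases "m = c")
    case True
    with Cons.prems have "\<forall>b\<in>set (a # r). c < b"
      by (metis le_neq_implies_less)
    then show ?thesis using True word_perm_fixes_below by blast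
  next
    case False
    with Cons.prems(5) have "m \<in> {m..<c}" by simp
    with Cons.prems(3) have "m \<in> set (a # r)" by blast
    with Cons.prems have a: "a = m" by force
    have "word_perm r c = Suc m"
    proof (rule Cons.IH)
      show "{Suc m..<c} \<subseteq> set r"
      proof
        fix t assume "t \<in> {Suc m..<c}"
        then have "t \<in> {m..<c}" "t \<noteq> m" by auto
        then show "t \<in> set r" using Cons.prems(3) a by auto
      qed
    qed (use Cons.prems a False in auto)
    then show ?thesis using a by simp
  qed
qed simp

text \<open>Row and column indices start from 0 here. The offset \<open>m\<close>, which is 1 for a whole tableau, grows by
  one when the first row is removed, so that the remaining cells keep their status.\<close>

definition frozen_at :: "nat \<Rightarrow> nat list list \<Rightarrow> nat \<Rightarrow> nat \<Rightarrow> bool" where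
  "frozen_at m P i j \<longleftrightarrow> i < length P \<and> j < length (P ! i) \<and> P ! i ! j = m + i + j"

lemma strictly_above_lower_bound:
  assumes "strictly_above r s" "\<forall>a\<in>set r. m \<le> a"
  shows "\<forall>a\<in>set s. Suc m \<le> a"
proof
  fix a assume "a \<in> set s"
  then obtain j where j: "j < length s" "s ! j = a" by (auto simp: in_set_conv_nth)
  then have "r ! j < a" "r ! j \<in> set r" using assms(1) by (auto simp: strictly_above_def)
  then show "Suc m \<le> a" using assms(2) by fastforce
qed

lemma reading_word_lower_bound:
  assumes "increasing_tableau P" "\<forall>a\<in>set (head_row P). m \<le> a"
  shows "\<forall>a\<in>set (reading_word P). m \<le> a"
  using assms
proof (induction P arbitrary: m)
  case (Cons r rs)
  have "\<forall>a\<in>set (head_row rs). Suc m \<le> a"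
    using strictly_above_lower_bound[of r "head_row rs" m] Cons.prems by simp
  then have "\<forall>a\<in>set (reading_word rs). Suc m \<le> a"
    using Cons.IH[of "Suc m"] Cons.prems by simp
  then show ?case using Cons.prems by auto
qed simp

lemma sorted_row_lower_bound:
  assumes "sorted_wrt (<) r" "\<forall>a\<in>set r. m \<le> a" "j < length r"
  shows "m + j \<le> r ! j"
  using assms(3)
proof (induction j)
  case 0
  then show ?case using assms(2) by simp
next
  case (Suc j)
  then have "r ! j < r ! Suc j"
    using assms(1) by (simp add: sorted_wrt_nth_less)
  then show ?case using Suc by simp
qed

lemma frozen_in_row:
  assumes r: "sorted_wrt (<) r" "\<forall>a\<in>set r. m \<le> a"
    and j: "j < length r" "r ! j \<le> m + j"
  shows "{m..m + j} \<subseteq> set r"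
  using j
proof (induction j)
  case 0
  then show ?case using r(2) by (metis add_0_right atLeastAtMost_singleton empty_subsetI
    insert_subset le_antisym nth_mem)
next
  case (Suc j)
  then have "r ! j < r ! Suc j"
    using r(1) by (simp add: sorted_wrt_nth_less)
  then have "{m..m + j} \<subseteq> set r" using Suc by simp
  moreover have "r ! Suc j = m + Suc j"
    using sorted_row_lower_bound[OF r Suc.prems(1)] Suc.prems(2) by simp
  then have "m + Suc j \<in> set r" using Suc.prems(1) nth_mem by metis
  ultimately show ?case by (auto simp: atLeastAtMostSuc_conv)
qed

text \<open>Let \<open>m + j\<close> stand in column \<open>k\<close>. Entries start at \<open>m\<close> or above and grow by at least one from
  column to column, so \<open>k \<le> j\<close>; and the \<open>j + 1\<close> letters of the interval all stand in the columns
  \<open>0, \<dots>, k\<close>, so \<open>j \<le> k\<close>.\<close>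

lemma row_contains_interval_frozen:
  assumes r: "sorted_wrt (<) r" "\<forall>a\<in>set r. m \<le> a" and sub: "{m..m + j} \<subseteq> set r"
  shows "j < length r \<and> r ! j = m + j"
proof -
  have "m + j \<in> set r" using sub by auto
  then obtain k where k: "k < length r" "r ! k = m + j" by (auto simp: in_set_conv_nth)
  have kj: "k \<le> j" using sorted_row_lower_bound[OF r k(1)] k(2) by simp
  have "{m..m + j} \<subseteq> (!) r ` {..k}"
  proof
    fix a assume a: "a \<in> {m..m + j}"
    then obtain l where l: "l < length r" "r ! l = a"
      using sub by (metis in_set_conv_nth subsetD)
    have "l \<le> k"
    proof (rule ccontr)
      assume "\<not> l \<le> k"
      then have "r ! k < r ! l" using r(1) l(1) by (simp add: sorted_wrt_nth_less)
      then show False using a l k by simp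
    qed
    then show "a \<in> (!) r ` {..k}" using l by auto
  qed
  then have "card {m..m + j} \<le> card ((!) r ` {..k})" by (intro card_mono) auto
  also have "\<dots> \<le> Suc k" using card_image_le[of "{..k}" "(!) r"] by simp
  finally have "j \<le> k" by simp
  with kj k show ?thesis by simp
qed

lemma column_growth:
  assumes "increasing_tableau P" "i < length P" "j < length (P ! i)"
  shows "j < length (head_row P) \<and> head_row P ! j + i \<le> P ! i ! j"
  using assms
proof (induction P arbitrary: i)
  case (Cons r rs)
  show ?case
  proof (cases i)
    case 0
    then show ?thesis using Cons.prems by simp
  next
    case (Suc i')
    with Cons have "j < length (head_row rs) \<and> head_row rs ! j + i' \<le> rs ! i' ! j" by simp
    with Cons.prems Suc show ?thesis by (force simp: strictly_above_def)
  qed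
qed simp

text \<open>Induction on the rows, with two cases for the first row \<open>r\<close>. If it contains \<open>m, \<dots>, m + j\<close>, then
  it shifts these arguments up by one and the claim for the remaining rows, with offset \<open>m + 1\<close>,
  applies. Otherwise no cell of column \<open>j\<close> is frozen, because entries grow down the column, and the first missing letter is sent
  to \<open>m\<close>, which the remaining rows fix.\<close>

lemma frozen_at_iff_word_perm:
  assumes "increasing_tableau P" "\<forall>a\<in>set (head_row P). m \<le> a"
  shows "frozen_at m P i j \<longleftrightarrow> (\<forall>c\<in>{m..m + j}. m + i < word_perm (reading_word P) c)"
  using assms
proof (induction P arbitrary: m i)
  case Nil
  then show ?case by (force simp: frozen_at_def)
next
  case (Cons r rs)
  then have r: "sorted_wrt (<) r" "\<forall>a\<in>set r. m \<le> a" and rs: "increasing_tableau rs" by auto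
  have rs_low: "\<forall>a\<in>set (head_row rs). Suc m \<le> a"
    using strictly_above_lower_bound[of r "head_row rs" m] Cons.prems by simp
  note read_low = reading_word_lower_bound[OF rs rs_low]
  show ?case
  proof (cases "{m..m + j} \<subseteq> set r")
    case True
    have step: "word_perm (reading_word (r # rs)) c = word_perm (reading_word rs) (Suc c)"
      if "c \<in> {m..m + j}" for c
      using word_perm_row_mem[OF r(1)] True that by auto
    show ?thesis
    proof (cases i)
      case 0
      have "frozen_at m (r # rs) i j"
        using row_contains_interval_frozen[OF r True] 0 by (simp add: frozen_at_def)
      moreover have "m + i < word_perm (reading_word (r # rs)) c" if "c \<in> {m..m + j}" for c
        using word_perm_preserves_lower_bound[OF read_low, of "Suc c"] step[OF that] that 0 by simp
      ultimately show ?thesis by blast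
    next
      case (Suc i')
      have "frozen_at m (r # rs) i j \<longleftrightarrow> frozen_at (Suc m) rs i' j"
        using Suc by (simp add: frozen_at_def)
      also have "\<dots> \<longleftrightarrow> (\<forall>c\<in>{Suc m..Suc m + j}. Suc m + i' < word_perm (reading_word rs) c)"
        using Cons.IH[OF rs rs_low] .
      also have "\<dots> \<longleftrightarrow> (\<forall>c\<in>{m..m + j}. Suc m + i' < word_perm (reading_word rs) (Suc c))"
        unfolding add_Suc[of m j] image_Suc_atLeastAtMost[symmetric] by blast
      also have "\<dots> \<longleftrightarrow> (\<forall>c\<in>{m..m + j}. m + i < word_perm (reading_word (r # rs)) c)"
        using step Suc by simp
      finally show ?thesis .
    qed
  next
    case False
    have "\<not> frozen_at m (r # rs) i j"
    proof
      assume "frozen_at m (r # rs) i j"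
      then have "j < length r" "r ! j \<le> m + j"
        using column_growth[OF Cons.prems(1), of i j] unfolding frozen_at_def by auto
      then show False using frozen_in_row[OF r] False by blast
    qed
    moreover have "\<not> (\<forall>c\<in>{m..m + j}. m + i < word_perm (reading_word (r # rs)) c)"
    proof -
      obtain c where c: "c \<in> {m..m + j}" "c \<notin> set r"
        and least: "\<forall>a<c. \<not> (a \<in> {m..m + j} \<and> a \<notin> set r)"
        using False exists_least_iff[of "\<lambda>c. c \<in> {m..m + j} \<and> c \<notin> set r"] by blast
      then have "{m..<c} \<subseteq> set r" by auto
      then have "word_perm r c = m" using word_perm_row_run r c by simp
      moreover have "word_perm (reading_word rs) m = m"
        using read_low by (intro word_perm_fixes_below) auto
      ultimately have "word_perm (reading_word (r # rs)) c = m" by simp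
      then show ?thesis using c(1) by force
    qed
    ultimately show ?thesis by blast
  qed
qed

definition northwest_free :: "(nat \<Rightarrow> nat) \<Rightarrow> (nat \<times> nat) set" where
  "northwest_free \<sigma> = {(r, c). 1 \<le> r \<and> 1 \<le> c \<and> (\<forall>c'\<in>{1..c}. r < \<sigma> c')}"

lemma frozen_region_eq_northwest_free:
  assumes "increasing_tableau P" "\<forall>a\<in>set (head_row P). 1 \<le> a"
  shows "frozen_region P = northwest_free (word_perm (reading_word P))"
proof -
  have "(i, j) \<in> frozen_region P \<longleftrightarrow> (i, j) \<in> northwest_free (word_perm (reading_word P))" for i j
  proof (cases "1 \<le> i \<and> 1 \<le> j")
    case True
    then obtain i' j' where ij: "i = Suc i'" "j = Suc j'"
      by (metis One_nat_def Suc_le_D)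
    have "(i, j) \<in> frozen_region P \<longleftrightarrow> frozen_at 1 P i' j'"
      unfolding ij by (auto simp: frozen_region_def tableau_cells_def tableau_entry_def frozen_at_def)
    also have "\<dots> \<longleftrightarrow> (i, j) \<in> northwest_free (word_perm (reading_word P))"
      using frozen_at_iff_word_perm[OF assms] by (auto simp: northwest_free_def ij)
    finally show ?thesis .
  next
    case False
    then show ?thesis
      by (auto simp: frozen_region_def tableau_cells_def northwest_free_def)
  qed
  then show ?thesis by auto
qed

section \<open>The top-left component\<close>

lemma northwest_free_subset_rothe_diagram:
  assumes "\<sigma> permutes {1..n}"
  shows "northwest_free \<sigma> \<subseteq> rothe_diagram n \<sigma>"
proof (rule subrelI)
  fix r c assume "(r, c) \<in> northwest_free \<sigma>"
  then have r: "1 \<le> r" and c: "1 \<le> c" and small: "\<And>c'. c' \<in> {1..c} \<Longrightarrow> r < \<sigma> c'"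
    by (auto simp: northwest_free_def)
  have "r \<in> {1..n}"
  proof (cases "1 \<in> {1..n}")
    case True
    then have "\<sigma> 1 \<in> {1..n}" using permutes_in_image[OF assms] by blast
    then show ?thesis using small[of 1] r c by simp
  next
    case False
    then have "\<sigma> 1 = 1" using assms by (rule permutes_not_in[rotated])
    then show ?thesis using small[of 1] r c by simp
  qed
  then have pre: "inv \<sigma> r \<in> {1..n}"
    using permutes_inv[OF assms] permutes_in_image by metis
  have "c < inv \<sigma> r"
  proof (rule ccontr)
    assume "\<not> c < inv \<sigma> r"
    then have "r < \<sigma> (inv \<sigma> r)" using small pre by simp
    then show False using permutes_inverses(1)[OF assms] by simp
  qed
  then show "(r, c) \<in> rothe_diagram n \<sigma>"
    using \<open>r \<in> {1..n}\<close> pre c small[of c] by (simp add: rothe_diagram_def)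
qed

lemma northwest_free_mono:
  "(r, c) \<in> northwest_free \<sigma> \<Longrightarrow> 1 \<le> r' \<Longrightarrow> r' \<le> r \<Longrightarrow> 1 \<le> c' \<Longrightarrow> c' \<le> c
    \<Longrightarrow> (r', c') \<in> northwest_free \<sigma>"
  by (force simp: northwest_free_def)

text \<open>A step to the right meets the condition on the new column because \<open>b\<close> lies in the diagram.
  After a step down, the condition could fail only if some \<open>\<sigma> d = r'\<close> with \<open>d \<le> c'\<close>, and this 1
  would lie weakly to the left of the diagram cell \<open>(r', c')\<close> in its row.\<close>

lemma northwest_free_adjacent:
  assumes perm: "\<sigma> permutes {1..n}" and a: "a \<in> northwest_free \<sigma>"
    and b: "b \<in> rothe_diagram n \<sigma>" and adj: "adjacent a b"
  shows "b \<in> northwest_free \<sigma>"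
proof -
  obtain r c r' c' where ab: "a = (r, c)" "b = (r', c')" by force
  have b': "1 \<le> r'" "1 \<le> c'" "r' < \<sigma> c'" "c' < inv \<sigma> r'"
    using b ab by (auto simp: rothe_diagram_def)
  consider "r' \<le> r" "c' \<le> c" | "r' = r" "c' = Suc c" | "r' = Suc r" "c' = c"
    using adj ab by (auto simp: adjacent_def) linarith
  then show ?thesis
  proof cases
    case 1
    then show ?thesis using northwest_free_mono a b' ab by blast
  next
    case 2
    then show ?thesis using a b' ab by (auto simp: northwest_free_def le_Suc_eq)
  next
    case 3
    have "r' < \<sigma> d" if d: "d \<in> {1..c'}" for d
    proof -
      have "r < \<sigma> d" using a ab d 3 by (auto simp: northwest_free_def)
      moreover have "\<sigma> d \<noteq> r'"
      proof
        assume "\<sigma> d = r'"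
        then have "inv \<sigma> r' = d" using permutes_inverses(2)[OF perm] by blast
        then show False using b' d by simp
      qed
      ultimately show ?thesis using 3 by simp
    qed
    then show ?thesis using b' ab by (simp add: northwest_free_def)
  qed
qed

lemma top_left_component_eq_northwest_free:
  assumes "\<sigma> permutes {1..n}"
  shows "top_left_component n \<sigma> = northwest_free \<sigma>"
proof
  let ?D = "rothe_diagram n \<sigma>"
  let ?E = "{(a, b). a \<in> ?D \<and> b \<in> ?D \<and> adjacent a b}"
  show "top_left_component n \<sigma> \<subseteq> northwest_free \<sigma>"
  proof
    fix q assume "q \<in> top_left_component n \<sigma>"
    then have D: "(1, 1) \<in> ?D" and path: "((1, 1), q) \<in> ?E\<^sup>*"
      by (auto simp: top_left_component_def component_def)
    from path show "q \<in> northwest_free \<sigma>"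
    proof (induction rule: rtrancl_induct)
      case base
      then show ?case using D by (auto simp: rothe_diagram_def northwest_free_def)
    next
      case (step p q)
      then show ?case using northwest_free_adjacent[OF assms] by blast
    qed
  qed
  show "northwest_free \<sigma> \<subseteq> top_left_component n \<sigma>"
  proof (rule subrelI)
    have edge: "(a, b) \<in> ?E" if "a \<in> northwest_free \<sigma>" "b \<in> northwest_free \<sigma>" "adjacent a b" for a b
      using that northwest_free_subset_rothe_diagram[OF assms] by blast
    fix r c assume rc: "(r, c) \<in> northwest_free \<sigma>"
    then have pos: "1 \<le> r" "1 \<le> c" by (auto simp: northwest_free_def)
    have row: "((1, 1), (1, c)) \<in> ?E\<^sup>*"
      using pos(2) rc
    proof (induction c rule: dec_induct)
      case (step c)
      then have nf: "(1, c) \<in> northwest_free \<sigma>" "(1, Suc c) \<in> northwest_free \<sigma>"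
        "(r, c) \<in> northwest_free \<sigma>"
        using northwest_free_mono[OF step.prems] pos(1) by auto
      then have "((1, c), (1, Suc c)) \<in> ?E" by (intro edge) (auto simp: adjacent_def)
      with step.IH nf show ?case by (meson rtrancl.rtrancl_into_rtrancl)
    qed simp
    have "((1, c), (r, c)) \<in> ?E\<^sup>*"
      using pos(1) rc
    proof (induction r rule: dec_induct)
      case (step r)
      then have nf: "(r, c) \<in> northwest_free \<sigma>"
        using northwest_free_mono[OF step.prems] pos(2) by auto
      then have "((r, c), (Suc r, c)) \<in> ?E"
        using step.prems by (intro edge) (auto simp: adjacent_def)
      with step.IH nf show ?case by (meson rtrancl.rtrancl_into_rtrancl)
    qed simp
    with row have "((1, 1), (r, c)) \<in> ?E\<^sup>*" by (rule rtrancl_trans)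
    moreover have "(1, 1) \<in> ?D"
      using northwest_free_mono[OF rc, of 1 1] pos northwest_free_subset_rothe_diagram[OF assms] by auto
    ultimately show "(r, c) \<in> top_left_component n \<sigma>"
      by (simp add: top_left_component_def component_def)
  qed
qed

section \<open>Finite order ideals are Young diagrams\<close>

lemma initial_segment_eq_card:
  fixes X :: "nat set"
  assumes "finite X" "0 \<notin> X" "\<And>x y. x \<in> X \<Longrightarrow> 1 \<le> y \<Longrightarrow> y \<le> x \<Longrightarrow> y \<in> X"
  shows "X = {1..card X}"
proof (cases "X = {}")
  case False
  have "X = {1..Max X}"
  proof
    show "X \<subseteq> {1..Max X}"
    proof
      fix x assume "x \<in> X"
      then have "x \<noteq> 0" "x \<le> Max X" using assms(1,2) by (metis, simp)
      then show "x \<in> {1..Max X}" by simp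
    qed
    show "{1..Max X} \<subseteq> X" using assms(3)[OF Max_in[OF assms(1) False]] by auto
  qed
  then have "card X = Max X" by (metis card_atLeastAtMost diff_Suc_1)
  with \<open>X = {1..Max X}\<close> show ?thesis by simp
qed simp

lemma is_young_diagramI:
  assumes fin: "finite A" and pos: "\<And>r c. (r, c) \<in> A \<Longrightarrow> 1 \<le> r \<and> 1 \<le> c"
    and mono: "\<And>r c r' c'. (r, c) \<in> A \<Longrightarrow> 1 \<le> r' \<Longrightarrow> r' \<le> r \<Longrightarrow> 1 \<le> c' \<Longrightarrow> c' \<le> c \<Longrightarrow> (r', c') \<in> A"
  shows "is_young_diagram A"
proof -
  define k where "k = card {r. (r, 1) \<in> A}"
  define f where "f r = card {c. (r, c) \<in> A}" for r
  have fin_row: "finite {c. (r, c) \<in> A}" for r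
    by (rule finite_subset[OF _ finite_imageI[OF fin, of snd]]) force
  have fin_col: "finite {r. (r, 1) \<in> A}"
    by (rule finite_subset[OF _ finite_imageI[OF fin, of fst]]) force
  have "{r. (r, 1) \<in> A} = {1..k}"
    unfolding k_def
  proof (rule initial_segment_eq_card[OF fin_col])
    show "0 \<notin> {r. (r, 1) \<in> A}" using pos[of 0 1] by auto
    show "r' \<in> {r. (r, 1) \<in> A}" if "r \<in> {r. (r, 1) \<in> A}" "1 \<le> r'" "r' \<le> r" for r r'
      using mono[of r 1 r' 1] that by simp
  qed
  then have rows: "(r, 1) \<in> A \<longleftrightarrow> 1 \<le> r \<and> r \<le> k" for r by force
  have "{c. (r, c) \<in> A} = {1..f r}" for r
    unfolding f_def
  proof (rule initial_segment_eq_card[OF fin_row])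
    show "0 \<notin> {c. (r, c) \<in> A}" using pos[of r 0] by auto
    show "c' \<in> {c. (r, c) \<in> A}" if "c \<in> {c. (r, c) \<in> A}" "1 \<le> c'" "c' \<le> c" for c c'
      using mono[of r c r c'] pos[of r c] that by simp
  qed
  then have cells: "(r, c) \<in> A \<longleftrightarrow> 1 \<le> c \<and> c \<le> f r" for r c by force
  define \<alpha> where "\<alpha> = map f [1..<Suc k]"
  have len: "length \<alpha> = k" and nth: "r < k \<Longrightarrow> \<alpha> ! r = f (Suc r)" for r
    by (simp_all add: \<alpha>_def del: upt_Suc)
  have "f s \<le> f r" if "1 \<le> r" "r \<le> s" for r s
  proof -
    have "{c. (s, c) \<in> A} \<subseteq> {c. (r, c) \<in> A}"
      using mono[of s _ r] pos[of s] that by blast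
    then show ?thesis unfolding f_def by (intro card_mono fin_row)
  qed
  then have "sorted_wrt (\<ge>) \<alpha>"
    by (auto simp: sorted_wrt_iff_nth_less len nth)
  moreover have "0 \<notin> set \<alpha>"
  proof
    assume "0 \<in> set \<alpha>"
    then obtain r where "r < k" "f (Suc r) = 0"
      by (auto simp: in_set_conv_nth len nth)
    then show False using rows[of "Suc r"] cells[of "Suc r" 1] by simp
  qed
  moreover have "A = young_diagram \<alpha>"
  proof -
    have "(r, c) \<in> A \<longleftrightarrow> (r, c) \<in> young_diagram \<alpha>" for r c
    proof (cases "1 \<le> r \<and> r \<le> k")
      case True
      then have "r - 1 < k" "Suc (r - 1) = r" by linarith+
      then have "\<alpha> ! (r - 1) = f r" using nth[of "r - 1"] by simp
      then show ?thesis using True cells by (simp add: young_diagram_def len)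
    next
      case False
      then have "(r, c) \<notin> A" using rows[of r] mono[of r c r 1] pos[of r c] by auto
      then show ?thesis using False by (auto simp: young_diagram_def len)
    qed
    then show ?thesis by auto
  qed
  ultimately show ?thesis unfolding is_young_diagram_def is_partition_def by blast
qed

lemma is_young_diagram_northwest_free:
  assumes "\<sigma> permutes {1..n}"
  shows "is_young_diagram (northwest_free \<sigma>)"
proof (rule is_young_diagramI)
  have "northwest_free \<sigma> \<subseteq> {1..n} \<times> {1..n}"
    using northwest_free_subset_rothe_diagram[OF assms] by (force simp: rothe_diagram_def)
  then show "finite (northwest_free \<sigma>)" by (rule finite_subset) simp
  show "(r', c') \<in> northwest_free \<sigma>"
    if "(r, c) \<in> northwest_free \<sigma>" "1 \<le> r'" "r' \<le> r" "1 \<le> c'" "c' \<le> c" for r c r' c'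
    using northwest_free_mono that .
qed (simp add: northwest_free_def)

theorem theorem3p3:
  fixes n :: nat and w :: "nat list" and \<sigma> :: "nat \<Rightarrow> nat"
  assumes "reduced_word n w"
    and "\<sigma> = word_perm w"
  shows "is_young_diagram (top_left_component n \<sigma>)
    \<and> is_young_diagram (frozen_region (insertion_tableau w))
    \<and> lambda_perm n \<sigma> = lambda_frozen w"
proof -
  have letters: "set w \<subseteq> {1..<n}" using assms(1) by (simp add: reduced_word_def)
  then have perm: "\<sigma> permutes {1..n}" unfolding assms(2) by (rule word_perm_permutes)
  have "\<forall>a\<in>set (head_row (insertion_tableau w)). 1 \<le> a"
    using set_head_row_insertion_tableau[of w] letters by fastforce
  then have "frozen_region (insertion_tableau w) = northwest_free \<sigma>"
    using frozen_region_eq_northwest_free[OF insertion_tableau_increasing]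
      reading_word_insertion_tableau[OF reduced_word_imp_shortest[OF assms(1)]] assms(2) by simp
  then show ?thesis
    using top_left_component_eq_northwest_free[OF perm] is_young_diagram_northwest_free[OF perm]
    by (simp add: lambda_perm_def lambda_frozen_def)
qed

end
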